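(* Let $(A,D)$ be a pseudo-Cartan inclusion with Cartan envelope $(A_1,D_1,\alpha)$. The map $J\mapsto \alpha(J)^{\perp\perp}$ (annihilators taken in $D_1$) is an isomorphism from the lattice $\mathrm{RegInv}_A(D)$ of invariant regular ideals of $D$ onto the lattice $\mathrm{RegInv}_{A_1}(D_1)$ of invariant regular ideals of $D_1$. The inverse map is given by $K\mapsto\alpha^{-1}(K)=\{d\in D:\alpha(d)\in K\}$.
   Context: Ideals are closed and two-sided. An inclusion $(A,B)$ of $C^*$-algebras is a $C^*$-algebra $A$ with a $C^*$-subalgebra $B\subseteq A$ containing an approximate unit for $A$. $N(A,B)=\{n\in A: nBn^*\subseteq B,\ n^*Bn\subseteq B\}$; the inclusion is regular if $N(A,B)$ has dense span in $A$. It has the ideal intersection property if $J\cap B\neq\{0\}$ for every non-zero ideal $J$ of $A$. A pseudo-Cartan inclusion is a regular inclusion $(A,D)$ such that $D$ is abelian, the relative commutant $D^c$ of $D$ in $A$ is abelian, and both $(D^c,D)$ and $(A,D^c)$ have the ideal intersection property. A Cartan inclusion is a regular inclusion $(A_1,D_1)$ with $D_1$ maximal abelian in $A_1$ and with a faithful conditional expectation $A_1\to D_1$. A Cartan envelope of a regular inclusion $(A,D)$ with $D$ abelian is a triple $(A_1,D_1,\alpha)$ where: $(A_1,D_1)$ is a Cartan inclusion with faithful conditional expectation $E_1\colon A_1\to D_1$; $\alpha\colon A\to A_1$ is a $*$-monomorphism with $\alpha(N(A,D))\subseteq N(A_1,D_1)$ and $\alpha(D)\subseteq D_1$; $A_1=C^*(\alpha(A)\cup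 E_1(\alpha(A)))$ and $D_1=C^*(E_1(\alpha(A)))$; and $(D_1,\alpha(D))$ has the ideal intersection property. For a subset $X$ of a $C^*$-algebra $B$, its annihilator in $B$ is $X^\perp=\{b\in B:bX=Xb=\{0\}\}$. An ideal $J$ of $B$ is regular if $J=J^{\perp\perp}$ (annihilators in $B$). For a regular inclusion $(A,B)$, an ideal $K$ of $B$ is invariant if $nKn^*\subseteq K$ for all $n\in N(A,B)$; $\mathrm{RegInv}_A(B)$ is the lattice of invariant regular ideals of $B$, ordered by inclusion. *)

theory Defs
  imports "HOL-Analysis.Analysis" "HOL-Algebra.Lattice"
begin

text \<open>
  Not necessarily unital complex C*-algebras. The superclasses provide a complete
  submultiplicative norm and the underlying real scalar multiplication, to which
  the complex one is tied by \<open>scaleR_scaleC\<close>.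
\<close>

class cstar_algebra = banach + real_normed_algebra +
  fixes scaleC :: "complex \<Rightarrow> 'a \<Rightarrow> 'a"  (infixr \<open>*\<^sub>C\<close> 75)
    and star :: "'a \<Rightarrow> 'a"
  assumes scaleR_scaleC: "r *\<^sub>R x = complex_of_real r *\<^sub>C x"
    and scaleC_add_right: "c *\<^sub>C (x + y) = c *\<^sub>C x + c *\<^sub>C y"
    and scaleC_add_left: "(c + d) *\<^sub>C x = c *\<^sub>C x + d *\<^sub>C x"
    and scaleC_scaleC: "c *\<^sub>C (d *\<^sub>C x) = (c * d) *\<^sub>C x"
    and mult_scaleC_left: "(c *\<^sub>C x) * y = c *\<^sub>C (x * y)"
    and mult_scaleC_right: "x * (c *\<^sub>C y) = c *\<^sub>C (x * y)"
    and norm_scaleC: "norm (c *\<^sub>C x) = cmod c * norm x"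
    and star_add: "star (x + y) = star x + star y"
    and star_scaleC: "star (c *\<^sub>C x) = cnj c *\<^sub>C star x"
    and star_mult: "star (x * y) = star y * star x"
    and star_star: "star (star x) = x"
    and norm_star_mult: "norm (star x * x) = (norm x)\<^sup>2"

instantiation complex :: cstar_algebra
begin

definition scaleC_complex :: "complex \<Rightarrow> complex \<Rightarrow> complex"
  where "scaleC_complex c x = c * x"

definition star_complex :: "complex \<Rightarrow> complex"
  where "star_complex = cnj"

instance
  by standard
    (auto simp: scaleC_complex_def star_complex_def scaleR_conv_of_real algebra_simps
      norm_mult power2_eq_square)

end

global_interpretation complex_vector:
  vector_space "scaleC :: complex \<Rightarrow> 'a \<Rightarrow> 'a::cstar_algebra"
  defines csubspace = complex_vector.subspace
    and cspan = complex_vector.span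
proof unfold_locales
  fix x :: 'a
  show "1 *\<^sub>C x = x"
    using scaleR_scaleC[of 1 x] by simp
qed (simp_all add: scaleC_add_right scaleC_add_left scaleC_scaleC)

text \<open>
  The C*-algebras below are C*-subalgebras of the ambient type, possibly the whole
  type. All notions are relative to these carrier sets, since \<open>D\<close>, its relative
  commutant and \<open>A\<close> have to be treated on the same footing.
\<close>

definition cstar_subalgebra :: "'a::cstar_algebra set \<Rightarrow> bool"
  where "cstar_subalgebra A \<longleftrightarrow>
    csubspace A \<and> closed A \<and> (\<forall>x\<in>A. \<forall>y\<in>A. x * y \<in> A) \<and> (\<forall>x\<in>A. star x \<in> A)"

definition cstar_generated :: "'a::cstar_algebra set \<Rightarrow> 'a set"
  where "cstar_generated X = cstar_subalgebra hull X"

definition abelian :: "'a::cstar_algebra set \<Rightarrow> bool"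
  where "abelian A \<longleftrightarrow> (\<forall>x\<in>A. \<forall>y\<in>A. x * y = y * x)"

definition relative_commutant :: "'a::cstar_algebra set \<Rightarrow> 'a set \<Rightarrow> 'a set"
  where "relative_commutant A D = {a \<in> A. \<forall>d\<in>D. a * d = d * a}"

definition positive_elements :: "'a::cstar_algebra set \<Rightarrow> 'a set"
  where "positive_elements A = {star x * x | x. x \<in> A}"

definition cstar_ideal :: "'a::cstar_algebra set \<Rightarrow> 'a set \<Rightarrow> bool"
  where "cstar_ideal A J \<longleftrightarrow>
    J \<subseteq> A \<and> csubspace J \<and> closed J \<and> (\<forall>a\<in>A. \<forall>x\<in>J. a * x \<in> J \<and> x * a \<in> J)"

text \<open>
  The approximate unit is a net of positive contractions in \<open>B\<close>; the net is
  represented by the (proper) filter of its tails.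
\<close>

definition has_approximate_unit_in :: "'a::cstar_algebra set \<Rightarrow> 'a set \<Rightarrow> bool"
  where "has_approximate_unit_in A B \<longleftrightarrow>
    (\<exists>F. F \<noteq> bot \<and>
      (\<forall>\<^sub>F u in F. u \<in> positive_elements B \<and> norm u \<le> 1) \<and>
      (\<forall>a\<in>A. ((\<lambda>u. u * a) \<longlongrightarrow> a) F \<and> ((\<lambda>u. a * u) \<longlongrightarrow> a) F))"

definition cstar_inclusion :: "'a::cstar_algebra set \<Rightarrow> 'a set \<Rightarrow> bool"
  where "cstar_inclusion A B \<longleftrightarrow>
    cstar_subalgebra A \<and> cstar_subalgebra B \<and> B \<subseteq> A \<and> has_approximate_unit_in A B"

definition normalizers :: "'a::cstar_algebra set \<Rightarrow> 'a set \<Rightarrow> 'a set"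
  where "normalizers A B =
    {n \<in> A. (\<forall>b\<in>B. n * b * star n \<in> B) \<and> (\<forall>b\<in>B. star n * b * n \<in> B)}"

definition regular_inclusion :: "'a::cstar_algebra set \<Rightarrow> 'a set \<Rightarrow> bool"
  where "regular_inclusion A B \<longleftrightarrow>
    cstar_inclusion A B \<and> closure (cspan (normalizers A B)) = A"

definition ideal_intersection_property :: "'a::cstar_algebra set \<Rightarrow> 'a set \<Rightarrow> bool"
  where "ideal_intersection_property A B \<longleftrightarrow>
    cstar_inclusion A B \<and> (\<forall>J. cstar_ideal A J \<and> J \<noteq> {0} \<longrightarrow> J \<inter> B \<noteq> {0})"

definition pseudo_cartan_inclusion :: "'a::cstar_algebra set \<Rightarrow> 'a set \<Rightarrow> bool"
  where "pseudo_cartan_inclusion A D \<longleftrightarrow>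
    regular_inclusion A D \<and> abelian D \<and> abelian (relative_commutant A D) \<and>
    ideal_intersection_property (relative_commutant A D) D \<and>
    ideal_intersection_property A (relative_commutant A D)"

definition maximal_abelian :: "'a::cstar_algebra set \<Rightarrow> 'a set \<Rightarrow> bool"
  where "maximal_abelian A D \<longleftrightarrow>
    cstar_subalgebra D \<and> D \<subseteq> A \<and> abelian D \<and>
    (\<forall>C. cstar_subalgebra C \<and> C \<subseteq> A \<and> abelian C \<and> D \<subseteq> C \<longrightarrow> C = D)"

definition clinear_on :: "'a::cstar_algebra set \<Rightarrow> ('a \<Rightarrow> 'b::cstar_algebra) \<Rightarrow> bool"
  where "clinear_on A f \<longleftrightarrow>
    (\<forall>x\<in>A. \<forall>y\<in>A. f (x + y) = f x + f y) \<and> (\<forall>c. \<forall>x\<in>A. f (c *\<^sub>C x) = c *\<^sub>C f x)"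

text \<open>
  Conditional expectations are the contractive positive projections onto \<open>D\<close> that are
  \<open>D\<close>-bimodule maps; by Tomiyama's theorem these are exactly the linear projections
  onto \<open>D\<close> of norm at most one. Only the values on \<open>A\<close> matter.
\<close>

definition conditional_expectation ::
    "'a::cstar_algebra set \<Rightarrow> 'a set \<Rightarrow> ('a \<Rightarrow> 'a) \<Rightarrow> bool"
  where "conditional_expectation A D E \<longleftrightarrow>
    clinear_on A E \<and> E ` A \<subseteq> D \<and> (\<forall>d\<in>D. E d = d) \<and>
    (\<forall>a\<in>A. norm (E a) \<le> norm a) \<and>
    E ` positive_elements A \<subseteq> positive_elements D \<and>
    (\<forall>a\<in>A. \<forall>d\<in>D. E (d * a) = d * E a \<and> E (a * d) = E a * d)"

definition faithful_conditional_expectation ::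
    "'a::cstar_algebra set \<Rightarrow> 'a set \<Rightarrow> ('a \<Rightarrow> 'a) \<Rightarrow> bool"
  where "faithful_conditional_expectation A D E \<longleftrightarrow>
    conditional_expectation A D E \<and> (\<forall>a\<in>A. E (star a * a) = 0 \<longrightarrow> a = 0)"

definition cartan_inclusion :: "'a::cstar_algebra set \<Rightarrow> 'a set \<Rightarrow> bool"
  where "cartan_inclusion A D \<longleftrightarrow>
    regular_inclusion A D \<and> maximal_abelian A D \<and>
    (\<exists>E. faithful_conditional_expectation A D E)"

definition star_monomorphism ::
    "'a::cstar_algebra set \<Rightarrow> 'b::cstar_algebra set \<Rightarrow> ('a \<Rightarrow> 'b) \<Rightarrow> bool"
  where "star_monomorphism A A1 \<alpha> \<longleftrightarrow>
    \<alpha> ` A \<subseteq> A1 \<and> clinear_on A \<alpha> \<and>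
    (\<forall>x\<in>A. \<forall>y\<in>A. \<alpha> (x * y) = \<alpha> x * \<alpha> y) \<and> (\<forall>x\<in>A. \<alpha> (star x) = star (\<alpha> x)) \<and>
    inj_on \<alpha> A"

definition cartan_envelope ::
    "'a::cstar_algebra set \<Rightarrow> 'a set \<Rightarrow> 'b::cstar_algebra set \<Rightarrow> 'b set \<Rightarrow> ('a \<Rightarrow> 'b) \<Rightarrow> bool"
  where "cartan_envelope A D A1 D1 \<alpha> \<longleftrightarrow>
    regular_inclusion A D \<and> abelian D \<and> cartan_inclusion A1 D1 \<and>
    star_monomorphism A A1 \<alpha> \<and>
    \<alpha> ` normalizers A D \<subseteq> normalizers A1 D1 \<and> \<alpha> ` D \<subseteq> D1 \<and>
    (\<exists>E1. faithful_conditional_expectation A1 D1 E1 \<and>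
      A1 = cstar_generated (\<alpha> ` A \<union> E1 ` \<alpha> ` A) \<and>
      D1 = cstar_generated (E1 ` \<alpha> ` A)) \<and>
    ideal_intersection_property D1 (\<alpha> ` D)"

definition annihilator :: "'a::cstar_algebra set \<Rightarrow> 'a set \<Rightarrow> 'a set"
  where "annihilator B X = {b \<in> B. \<forall>x\<in>X. b * x = 0 \<and> x * b = 0}"

definition regular_ideal :: "'a::cstar_algebra set \<Rightarrow> 'a set \<Rightarrow> bool"
  where "regular_ideal B J \<longleftrightarrow> cstar_ideal B J \<and> J = annihilator B (annihilator B J)"

definition invariant_ideal :: "'a::cstar_algebra set \<Rightarrow> 'a set \<Rightarrow> 'a set \<Rightarrow> bool"
  where "invariant_ideal A B K \<longleftrightarrow>
    cstar_ideal B K \<and> (\<forall>n\<in>normalizers A B. \<forall>k\<in>K. n * k * star n \<in> K)"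

definition RegInv :: "'a::cstar_algebra set \<Rightarrow> 'a set \<Rightarrow> 'a set gorder"
  where "RegInv A B =
    \<lparr>carrier = {K. regular_ideal B K \<and> invariant_ideal A B K}, eq = (=), le = (\<subseteq>)\<rparr>"

text \<open>
  \<^const>\<open>join_pres\<close> and \<^const>\<open>meet_pres\<close> include that both orders are lattices.
\<close>

definition lattice_isomorphism ::
    "('a, 'c) gorder_scheme \<Rightarrow> ('b, 'd) gorder_scheme \<Rightarrow> ('a \<Rightarrow> 'b) \<Rightarrow> bool"
  where "lattice_isomorphism L M f \<longleftrightarrow>
    bij_betw f (carrier L) (carrier M) \<and> join_pres L M f \<and> meet_pres L M f"

end

theory Submission
  imports Defs
begin

text \<open>
  Write \<open>\<Phi> J = \<alpha>(J)\<^sup>\<bottom>\<^sup>\<bottom>\<close> and \<open>\<Psi> K = \<alpha>\<^sup>-\<^sup>1(K)\<close>.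

  That \<open>\<Phi>\<close> and \<open>\<Psi>\<close> are mutually inverse between regular ideals takes place inside the
  abelian algebra \<open>D1\<close> and rests on one fact, \<open>annihilator_Int_eq\<close>: by the ideal
  intersection property, an ideal \<open>K\<close> of \<open>D1\<close> and its trace \<open>K \<inter> \<alpha>(D)\<close> have the same
  annihilator in \<open>D1\<close>. Injectivity of \<open>\<alpha>\<close> gives \<open>\<Psi> (\<alpha>(J)\<^sup>\<bottom>) = J\<^sup>\<bottom>\<close>, the second annihilator
  being taken in \<open>D\<close>. Together these let one move any double annihilator between the two
  algebras.

  That \<open>\<Psi> K\<close> is invariant is immediate from \<open>\<alpha>(N(A,D)) \<subseteq> N(A1,D1)\<close>. The content of the
  theorem is that \<open>K = \<Phi> J\<close> is invariant under all of \<open>N(A1,D1)\<close>, which may contain far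
  more than the normalizers coming from \<open>A\<close>. Annihilators inherit invariance
  (\<open>annihilator_preserved\<close>), so \<open>K\<close> is at least invariant under \<open>\<alpha>(N(A,D))\<close>, and trivially
  under \<open>D1\<close>. Every \<open>m\<close> which preserves \<open>K\<close> satisfies \<open>K\<^sup>\<bottom> m K = 0\<close>. Unlike invariance, this
  condition is linear and closed in \<open>m\<close>, so it extends to the closed span of all such \<open>m\<close>.
  That span is a C*-algebra containing \<open>D1\<close> and \<open>\<alpha>(A)\<close>, hence equals \<open>A1\<close>. Now
  \<open>K\<^sup>\<bottom> n K = 0\<close> for every normalizer \<open>n\<close> of \<open>D1\<close> says that \<open>n K n\<^sup>*\<close> lies in
  \<open>K\<^sup>\<bottom>\<^sup>\<bottom> = K\<close> (\<open>regular_ideal_invariantI\<close>).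

  Passing from the span of \<open>N(A,D)\<close> to its closure \<open>A\<close> requires \<open>\<alpha>\<close> to be continuous.
  This is proved without spectral theory: a self-adjoint strict contraction \<open>h\<close> has a
  self-adjoint commuting \<open>s\<close> with \<open>h\<^sup>2 + (1 - s)\<^sup>2 = 1\<close>, which makes \<open>h + \<i>(1 - s)\<close> a unitary
  of the unitization; this algebraic relation survives a star-homomorphism and bounds
  the norm of the image of \<open>h\<close>.

  Finally, \<open>\<Phi>\<close> and \<open>\<Psi>\<close> are monotone, so they form an order isomorphism. Both orders are
  lattices, with intersections as meets and \<open>(J\<^sup>\<bottom> \<inter> K\<^sup>\<bottom>)\<^sup>\<bottom>\<close> as joins, and an order
  isomorphism of lattices preserves joins and meets.
\<close>

section \<open>The involution\<close>

lemma star_0 [simp]: "star (0::'a::cstar_algebra) = 0"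
  using star_add[of "0::'a" 0] by simp

lemma star_minus: "star (- x) = - star (x::'a::cstar_algebra)"
  using star_add[of x "- x"] by (simp add: eq_neg_iff_add_eq_0 add.commute)

lemma star_diff: "star (x - y) = star x - star (y::'a::cstar_algebra)"
  using star_add[of x "- y"] by (simp add: star_minus)

lemma star_scaleR: "star (r *\<^sub>R x) = r *\<^sub>R star (x::'a::cstar_algebra)"
  by (simp add: scaleR_scaleC star_scaleC)

lemma norm_star [simp]: "norm (star x) = norm (x::'a::cstar_algebra)"
proof -
  have le: "norm y \<le> norm (star y)" for y :: 'a
  proof (cases "y = 0")
    case False
    have "norm y * norm y \<le> norm (star y) * norm y"
      using norm_mult_ineq[of "star y" y] by (simp add: norm_star_mult power2_eq_square)
    with False show ?thesis by simp
  qed simp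
  show ?thesis
    using le[of x] le[of "star x"] by (simp add: star_star)
qed

lemma mult_star_self_eq_0D: "x * star x = 0 \<Longrightarrow> x = (0::'a::cstar_algebra)"
  using norm_star_mult[of "star x"] by (simp add: star_star)

lemma bounded_linear_star: "bounded_linear (star :: 'a::cstar_algebra \<Rightarrow> 'a)"
  by (rule bounded_linear_intro[where K = 1]) (simp_all add: star_add star_scaleR)

lemma bounded_linear_scaleC: "bounded_linear (scaleC c :: 'a::cstar_algebra \<Rightarrow> 'a)"
  by (rule bounded_linear_intro[where K = "cmod c"])
    (simp_all add: scaleC_add_right scaleR_scaleC scaleC_scaleC norm_scaleC mult.commute)

section \<open>Star-subalgebras and annihilators\<close>

lemma cstar_subalgebraD:
  assumes "cstar_subalgebra A"
  shows "0 \<in> A" "x \<in> A \<Longrightarrow> y \<in> A \<Longrightarrow> x + y \<in> A" "x \<in> A \<Longrightarrow> c *\<^sub>C x \<in> A"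
    "x \<in> A \<Longrightarrow> y \<in> A \<Longrightarrow> x * y \<in> A" "x \<in> A \<Longrightarrow> star x \<in> A" "closed A"
    "x \<in> A \<Longrightarrow> r *\<^sub>R x \<in> A" "x \<in> A \<Longrightarrow> y \<in> A \<Longrightarrow> x - y \<in> A"
  using assms complex_vector.subspace_diff[of A x y]
  by (auto simp: cstar_subalgebra_def scaleR_scaleC complex_vector.subspace_def)

lemma cstar_subalgebra_closure_cspan:
  fixes G :: "'a::cstar_algebra set"
  assumes mult: "\<And>x y. x \<in> G \<Longrightarrow> y \<in> G \<Longrightarrow> x * y \<in> G" and star: "\<And>x. x \<in> G \<Longrightarrow> star x \<in> G"
  shows "cstar_subalgebra (closure (cspan G))"
proof -
  note sub = complex_vector.subspace_span[of G, unfolded complex_vector.subspace_def]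
  have 1: "g * y \<in> cspan G" if "g \<in> G" "y \<in> cspan G" for g y
    using that(2)
    by (rule complex_vector.span_induct)
      (use that(1) sub in \<open>auto simp: complex_vector.subspace_def distrib_left mult_scaleC_right
        intro: mult complex_vector.span_base\<close>)
  have 2: "x * y \<in> cspan G" if "x \<in> cspan G" "y \<in> cspan G" for x y
    using that(1)
    by (rule complex_vector.span_induct)
      (use that(2) sub 1 in \<open>auto simp: complex_vector.subspace_def distrib_right mult_scaleC_left\<close>)
  have 3: "star x \<in> cspan G" if "x \<in> cspan G" for x
    using that
    by (rule complex_vector.span_induct)
      (use sub star in \<open>auto simp: complex_vector.subspace_def star_add star_scaleC
        intro: complex_vector.span_base\<close>)
  have lin: "f x \<in> closure (cspan G)"
    if f: "bounded_linear f" "f ` cspan G \<subseteq> cspan G" and x: "x \<in> closure (cspan G)" for f x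
  proof -
    obtain X where X: "\<And>n. X n \<in> cspan G" "X \<longlonglongrightarrow> x"
      using x unfolding closure_sequential by blast
    show ?thesis
      unfolding closure_sequential
      using X f(2) bounded_linear.tendsto[OF f(1) X(2)]
      by (intro exI[of _ "\<lambda>n. f (X n)"]) auto
  qed
  have bin: "x + y \<in> closure (cspan G) \<and> x * y \<in> closure (cspan G)"
    if xy: "x \<in> closure (cspan G)" "y \<in> closure (cspan G)" for x y
  proof -
    obtain X Y where X: "\<And>n. X n \<in> cspan G" "X \<longlonglongrightarrow> x" and Y: "\<And>n. Y n \<in> cspan G" "Y \<longlonglongrightarrow> y"
      using xy unfolding closure_sequential by blast
    show ?thesis
      unfolding closure_sequential
      using X Y sub 2 tendsto_add[OF X(2) Y(2)] tendsto_mult[OF X(2) Y(2)]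
      by (intro conjI exI[of _ "\<lambda>n. X n + Y n"] exI[of _ "\<lambda>n. X n * Y n"]) auto
  qed
  have "0 \<in> closure (cspan G)"
    using sub closure_subset by blast
  moreover have "c *\<^sub>C x \<in> closure (cspan G)" if "x \<in> closure (cspan G)" for c x
    using lin[OF bounded_linear_scaleC _ that] sub by (simp add: image_subset_iff)
  moreover have "star x \<in> closure (cspan G)" if "x \<in> closure (cspan G)" for x
    using lin[OF bounded_linear_star _ that] 3 by auto
  ultimately show ?thesis
    using bin by (auto simp: cstar_subalgebra_def complex_vector.subspace_def)
qed

lemma annihilator_antimono: "X \<subseteq> Y \<Longrightarrow> annihilator D Y \<subseteq> annihilator D X"
  by (auto simp: annihilator_def)

lemma subset_annihilator_annihilator:
  "X \<subseteq> D \<Longrightarrow> X \<subseteq> annihilator D (annihilator D X)"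
  by (auto simp: annihilator_def)

lemma annihilator_subset: "annihilator D X \<subseteq> D"
  by (auto simp: annihilator_def)

lemma annihilator_annihilator_annihilator:
  "X \<subseteq> D \<Longrightarrow> annihilator D (annihilator D (annihilator D X)) = annihilator D X"
  by (intro subset_antisym annihilator_antimono subset_annihilator_annihilator annihilator_subset)

text \<open>
  Asking for both conjugations makes the set of all such \<open>m\<close> closed under adjoints as well
  as products, so that its closed span is a C*-algebra.
\<close>

definition preserves :: "'a::cstar_algebra \<Rightarrow> 'a set \<Rightarrow> bool"
  where "preserves m X \<longleftrightarrow> (\<forall>x\<in>X. m * x * star m \<in> X) \<and> (\<forall>x\<in>X. star m * x * m \<in> X)"

lemma preserves_star: "preserves m X \<Longrightarrow> preserves (star m) X"
  by (auto simp: preserves_def star_star)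

lemma preserves_mult:
  assumes "preserves m X" "preserves n X"
  shows "preserves (m * n) X"
proof -
  have "(m * n) * x * star (m * n) = m * (n * x * star n) * star m"
    "star (m * n) * x * (m * n) = star n * (star m * x * m) * n" for x
    by (simp_all add: star_mult mult.assoc)
  with assms show ?thesis by (auto simp: preserves_def)
qed

lemma normalizer_preserves: "n \<in> normalizers A D \<Longrightarrow> preserves n D"
  by (auto simp: normalizers_def preserves_def)

lemma star_normalizer: "cstar_subalgebra A \<Longrightarrow> n \<in> normalizers A D \<Longrightarrow> star n \<in> normalizers A D"
  by (auto simp: normalizers_def star_star intro: cstar_subalgebraD)

lemma invariant_ideal_iff_preserves:
  assumes "cstar_subalgebra A"
  shows "invariant_ideal A D K \<longleftrightarrow>
    cstar_ideal D K \<and> (\<forall>n\<in>normalizers A D. preserves n K)"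
  using star_normalizer[OF assms] unfolding invariant_ideal_def preserves_def
  by (metis star_star)

lemma cstar_ideal_mult_star:
  "cstar_subalgebra D \<Longrightarrow> cstar_ideal D K \<Longrightarrow> k \<in> K \<Longrightarrow> k * star k \<in> K"
  unfolding cstar_ideal_def by (meson cstar_subalgebraD(5) subsetD)

locale abelian_cstar_subalgebra =
  fixes D :: "'a::cstar_algebra set"
  assumes subalgebra: "cstar_subalgebra D" and abelian: "abelian D"
begin

lemma commute: "x \<in> D \<Longrightarrow> y \<in> D \<Longrightarrow> x * y = y * x"
  using abelian by (auto simp: abelian_def)

text \<open>
  A square-zero \<open>x\<close> vanishes because \<open>x x\<^sup>*\<close> is self-adjoint and, by commutativity, again has
  square zero; the C*-identity is applied twice.
\<close>

lemma square_eq_0D: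
  assumes "x \<in> D" "x * x = 0"
  shows "x = 0"
proof (rule mult_star_self_eq_0D, rule mult_star_self_eq_0D)
  have "x * star x * star (x * star x) = x * (star x * x) * star x"
    by (simp add: star_mult star_star mult.assoc commute)
  also have "star x * x = x * star x"
    using assms(1) by (intro commute cstar_subalgebraD(5)[OF subalgebra])
  also have "x * (x * star x) * star x = (x * x) * star x * star x"
    by (simp only: mult.assoc)
  finally show "x * star x * star (x * star x) = 0"
    using assms(2) by simp
qed

lemma annihilator_eq:
  assumes "X \<subseteq> D"
  shows "annihilator D X = {b \<in> D. \<forall>x\<in>X. b * x = 0}"
  using assms commute by (fastforce simp: annihilator_def)

lemma cstar_ideal_annihilator:
  assumes "X \<subseteq> D"
  shows "cstar_ideal D (annihilator D X)"
proof -
  have "annihilator D X = D \<inter> (\<Inter>x\<in>X. {b. b * x = 0})"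
    using annihilator_eq[OF assms] by auto
  moreover have "closed {b. b * x = 0}" for x :: 'a
    by (intro closed_Collect_eq continuous_intros)
  ultimately have "closed (annihilator D X)"
    using cstar_subalgebraD(6)[OF subalgebra] by (metis closed_INT closed_Int)
  moreover have "csubspace (annihilator D X)"
    using cstar_subalgebraD[OF subalgebra] annihilator_eq[OF assms]
    by (auto simp: complex_vector.subspace_def distrib_right mult_scaleC_left)
  moreover have "a * b \<in> annihilator D X" if "a \<in> D" "b \<in> annihilator D X" for a b
    using that cstar_subalgebraD(4)[OF subalgebra] annihilator_eq[OF assms]
    by (auto simp: mult.assoc)
  ultimately show ?thesis
    using annihilator_subset[of D X] commute unfolding cstar_ideal_def by (metis subsetD)
qed

lemma regular_ideal_iff:
  "regular_ideal D J \<longleftrightarrow> J \<subseteq> D \<and> annihilator D (annihilator D J) = J"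
  unfolding regular_ideal_def
  using cstar_ideal_annihilator[OF annihilator_subset, of J] by (auto simp: cstar_ideal_def)

lemma regular_ideal_annihilator: "X \<subseteq> D \<Longrightarrow> regular_ideal D (annihilator D X)"
  by (simp add: regular_ideal_iff annihilator_subset annihilator_annihilator_annihilator)

text \<open>
  If \<open>y X = 0\<close> and \<open>w = n y n\<^sup>* x\<close>, then \<open>w w\<^sup>* = n y (n\<^sup>* x x\<^sup>* n) y\<^sup>* n\<^sup>*\<close>, and the bracket lies
  in \<open>X\<close>. The set need not be an ideal: the case of interest is \<open>\<alpha>(J)\<close>, which is an ideal of
  \<open>\<alpha>(D)\<close> but in general not of \<open>D1\<close>.
\<close>

lemma annihilator_preserved:
  assumes X: "X \<subseteq> D" "\<And>x. x \<in> X \<Longrightarrow> x * star x \<in> X"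
    and m: "preserves m D" "preserves m X"
  shows "preserves m (annihilator D X)"
proof -
  have *: "n * y * star n \<in> annihilator D X"
    if n: "preserves n D" "preserves n X" and y: "y \<in> annihilator D X" for n y
    unfolding annihilator_eq[OF X(1)]
  proof (intro CollectI conjI ballI)
    show "n * y * star n \<in> D"
      using n(1) y annihilator_subset by (auto simp: preserves_def)
    fix x assume x: "x \<in> X"
    have "y * (star n * (x * star x) * n) = 0"
      using y n(2) X(2)[OF x] by (auto simp: preserves_def annihilator_def)
    moreover have "(n * y * star n * x) * star (n * y * star n * x) =
        n * (y * (star n * (x * star x) * n)) * (star y * star n)"
      by (simp add: star_mult star_star mult.assoc)
    ultimately have "(n * y * star n * x) * star (n * y * star n * x) = 0"
      by simp
    then show "n * y * star n * x = 0"
      by (rule mult_star_self_eq_0D)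
  qed
  show ?thesis
    using *[OF m] *[OF m[THEN preserves_star]] unfolding preserves_def star_star by blast
qed

text \<open>
  If \<open>x\<close> annihilates \<open>K \<inter> B\<close>, then \<open>x K\<close> lies in the ideal
  \<open>I = K \<inter> (K \<inter> B)\<^sup>\<bottom>\<close>. Elements of \<open>I \<inter> B\<close> have square zero, so \<open>I\<close> meets \<open>B\<close> trivially
  and therefore vanishes.
\<close>

lemma annihilator_Int_eq:
  assumes iip: "ideal_intersection_property D B" and K: "cstar_ideal D K"
  shows "annihilator D (K \<inter> B) = annihilator D K"
proof (rule subset_antisym)
  have KD: "K \<subseteq> D" and sub: "K \<inter> B \<subseteq> D"
    using K by (auto simp: cstar_ideal_def)
  note ideal = cstar_ideal_annihilator[OF sub]
  let ?I = "K \<inter> annihilator D (K \<inter> B)"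
  have "cstar_ideal D ?I"
    using K ideal complex_vector.subspace_inter[of K "annihilator D (K \<inter> B)"] closed_Int
    unfolding cstar_ideal_def by blast
  moreover have "x = 0" if "x \<in> ?I \<inter> B" for x
    using that KD by (auto simp: annihilator_def intro!: square_eq_0D[of x])
  moreover have "0 \<in> ?I \<inter> B"
  proof -
    have "0 \<in> B"
      using iip by (auto simp: ideal_intersection_property_def cstar_inclusion_def
          intro: cstar_subalgebraD)
    then show ?thesis
      using K ideal by (auto simp: cstar_ideal_def complex_vector.subspace_def)
  qed
  ultimately have I: "?I = {0}"
    using iip unfolding ideal_intersection_property_def by blast
  show "annihilator D (K \<inter> B) \<subseteq> annihilator D K"
  proof
    fix x assume x: "x \<in> annihilator D (K \<inter> B)"
    then have xD: "x \<in> D" by (auto simp: annihilator_def)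
    have "x * k \<in> ?I" if "k \<in> K" for k
      using that K ideal x xD KD unfolding cstar_ideal_def by auto
    then show "x \<in> annihilator D K"
      using I xD by (auto simp: annihilator_eq[OF KD])
  qed
qed (simp add: annihilator_antimono)

end

section \<open>The lattice of invariant regular ideals\<close>

lemma RegInv_simps [simp]:
  "carrier (RegInv A D) = {K. regular_ideal D K \<and> invariant_ideal A D K}"
  "le (RegInv A D) = (\<subseteq>)" "eq (RegInv A D) = (=)"
  by (simp_all add: RegInv_def)

context abelian_cstar_subalgebra
begin

lemma annihilator_in_RegInv:
  assumes A: "cstar_subalgebra A" and X: "X \<subseteq> D" "\<And>x. x \<in> X \<Longrightarrow> x * star x \<in> X"
    and inv: "\<And>n. n \<in> normalizers A D \<Longrightarrow> preserves n X"
  shows "annihilator D X \<in> carrier (RegInv A D)"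
  using annihilator_preserved[OF X normalizer_preserves inv] cstar_ideal_annihilator[OF X(1)]
    regular_ideal_annihilator[OF X(1)]
  by (auto simp: invariant_ideal_iff_preserves[OF A])

lemma annihilator_RegInv:
  assumes "cstar_subalgebra A" "J \<in> carrier (RegInv A D)"
  shows "annihilator D J \<in> carrier (RegInv A D)"
  using assms cstar_ideal_mult_star[OF subalgebra]
  by (intro annihilator_in_RegInv)
    (auto simp: invariant_ideal_iff_preserves regular_ideal_iff)

lemma Int_in_RegInv:
  assumes A: "cstar_subalgebra A" and J: "J \<in> carrier (RegInv A D)" "K \<in> carrier (RegInv A D)"
  shows "J \<inter> K \<in> carrier (RegInv A D)"
proof -
  have sub: "J \<subseteq> D" "K \<subseteq> D"
    and eq: "annihilator D (annihilator D J) = J" "annihilator D (annihilator D K) = K"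
    using J by (auto simp: regular_ideal_iff)
  have "annihilator D (annihilator D (J \<inter> K)) \<subseteq> J \<inter> K"
    using annihilator_antimono[OF annihilator_antimono] eq
    by (metis Int_greatest inf_le1 inf_le2)
  then have "regular_ideal D (J \<inter> K)"
    using sub subset_annihilator_annihilator[of "J \<inter> K" D] by (auto simp: regular_ideal_iff)
  moreover have "invariant_ideal A D (J \<inter> K)"
    using J calculation by (auto simp: invariant_ideal_def regular_ideal_def)
  ultimately show ?thesis by simp
qed

lemma lattice_RegInv:
  assumes A: "cstar_subalgebra A"
  shows "lattice (RegInv A D)"
proof unfold_locales
  fix J K assume JK: "J \<in> carrier (RegInv A D)" "K \<in> carrier (RegInv A D)"
  note inter = Int_in_RegInv[OF A]
  show "\<exists>s. greatest (RegInv A D) s (Lower (RegInv A D) {J, K})"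
    using JK inter[OF JK] by (intro exI[of _ "J \<inter> K"]) (auto simp: greatest_def Lower_def)
  let ?S = "annihilator D (annihilator D J \<inter> annihilator D K)"
  have S: "?S \<in> carrier (RegInv A D)"
    by (intro annihilator_RegInv[OF A] inter JK)
  have sub: "L \<subseteq> D" and eq: "annihilator D (annihilator D L) = L"
    if "L \<in> carrier (RegInv A D)" for L
    using that by (auto simp: regular_ideal_iff)
  have "J \<subseteq> ?S" "K \<subseteq> ?S"
    using eq[OF JK(1)] eq[OF JK(2)] annihilator_antimono by (metis inf_le1 inf_le2)+
  moreover have "?S \<subseteq> L" if "L \<in> carrier (RegInv A D)" "J \<subseteq> L" "K \<subseteq> L" for L
    using eq[OF that(1)] that annihilator_antimono by (metis Int_greatest)
  ultimately show "\<exists>s. least (RegInv A D) s (Upper (RegInv A D) {J, K})"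
    using JK S by (intro exI[of _ ?S]) (auto simp: least_def Upper_def)
qed auto

end

lemma order_isomorphism_lattice_isomorphism:
  assumes L: "lattice L" and M: "lattice M" and bij: "bij_betw f (carrier L) (carrier M)"
    and emb: "\<And>x y. x \<in> carrier L \<Longrightarrow> y \<in> carrier L \<Longrightarrow> le M (f x) (f y) \<longleftrightarrow> le L x y"
  shows "lattice_isomorphism L M f"
proof -
  have f: "f x \<in> carrier M" if "x \<in> carrier L" for x
    using that bij by (auto simp: bij_betw_def)
  have surj: "\<exists>x\<in>carrier L. f x = y" if "y \<in> carrier M" for y
    using that bij_betw_imp_surj_on[OF bij] by (metis imageE)
  interpret L: lattice L by fact
  interpret M: lattice M by fact
  have "f (x \<squnion>\<^bsub>L\<^esub> y) = f x \<squnion>\<^bsub>M\<^esub> f y" if xy: "x \<in> carrier L" "y \<in> carrier L" for x y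
  proof (rule M.le_antisym)
    obtain z where z: "z \<in> carrier L" "f z = f x \<squnion>\<^bsub>M\<^esub> f y"
      using surj f xy by (meson M.join_closed)
    have "le L x z" "le L y z"
      using z f xy emb M.join_left M.join_right by metis+
    then show "le M (f (x \<squnion>\<^bsub>L\<^esub> y)) (f x \<squnion>\<^bsub>M\<^esub> f y)"
      using z xy emb L.join_le L.join_closed by metis
    show "le M (f x \<squnion>\<^bsub>M\<^esub> f y) (f (x \<squnion>\<^bsub>L\<^esub> y))"
      using f xy emb L.join_left L.join_right L.join_closed M.join_le by simp
  qed (use f xy in auto)
  moreover have "f (x \<sqinter>\<^bsub>L\<^esub> y) = f x \<sqinter>\<^bsub>M\<^esub> f y" if xy: "x \<in> carrier L" "y \<in> carrier L" for x y
  proof (rule M.le_antisym)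
    obtain z where z: "z \<in> carrier L" "f z = f x \<sqinter>\<^bsub>M\<^esub> f y"
      using surj f xy by (meson M.meet_closed)
    have "le L z x" "le L z y"
      using z f xy emb M.meet_left M.meet_right by metis+
    then show "le M (f x \<sqinter>\<^bsub>M\<^esub> f y) (f (x \<sqinter>\<^bsub>L\<^esub> y))"
      using z xy emb L.meet_le L.meet_closed by metis
    show "le M (f (x \<sqinter>\<^bsub>L\<^esub> y)) (f x \<sqinter>\<^bsub>M\<^esub> f y)"
      using f xy emb L.meet_left L.meet_right L.meet_closed M.meet_le by simp
  qed (use f xy in auto)
  ultimately show ?thesis
    using L M bij by (auto simp: lattice_isomorphism_def join_pres_def meet_pres_def)
qed

section \<open>Star-homomorphisms are bounded\<close>

text \<open>
  The quadratic relation says \<open>(1 - s)\<^sup>2 = 1 - h\<^sup>2\<close>, written without a unit. It is equivalent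
  to \<open>s = (h\<^sup>2 + s\<^sup>2) / 2\<close>, and on the ball of radius \<open>\<parallel>h\<parallel> < 1\<close> the right-hand side is a
  contraction with constant \<open>\<parallel>h\<parallel>\<close>.
\<close>

lemma selfadjoint_complement_exists:
  assumes A: "cstar_subalgebra A" and h: "h \<in> A" "star h = h" "norm h < 1"
  obtains s where "s \<in> A" "star s = s" "s * h = h * s" "h * h + s * s = 2 *\<^sub>R s"
proof -
  let ?S = "{s \<in> A. norm s \<le> norm h \<and> star s = s \<and> s * h = h * s}"
  let ?f = "\<lambda>s. (1/2) *\<^sub>R (h * h + s * s)"
  have S: "?S = A \<inter> {s. norm s \<le> norm h} \<inter> {s. star s = s} \<inter> {s. s * h = h * s}"
    by auto
  have "closed ?S"
    unfolding S
    by (intro closed_Int closed_Collect_le closed_Collect_eq continuous_intros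
        cstar_subalgebraD(6)[OF A] linear_continuous_on bounded_linear_star)
  then have "complete ?S"
    by (simp add: complete_eq_closed)
  moreover have "?S \<noteq> {}"
    using cstar_subalgebraD(1)[OF A] by (auto intro!: exI[of _ 0])
  moreover have "?f ` ?S \<subseteq> ?S"
  proof (intro image_subsetI CollectI conjI)
    fix s assume s: "s \<in> ?S"
    have "norm (h * h + s * s) \<le> norm h * norm h + norm s * norm s"
      by (meson norm_triangle_le add_mono norm_mult_ineq)
    also have "\<dots> \<le> norm h * 1 + norm h * 1"
      using s h(3) by (intro add_mono mult_mono) auto
    finally show "norm (?f s) \<le> norm h" by simp
    show "?f s * h = h * ?f s"
      using s by (simp add: distrib_left distrib_right) (metis mult.assoc)
  qed (use h cstar_subalgebraD[OF A] in \<open>auto simp: star_scaleR star_add star_mult\<close>)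
  moreover have "dist (?f s) (?f t) \<le> norm h * dist s t" if st: "s \<in> ?S" "t \<in> ?S" for s t
  proof -
    have "?f s - ?f t = (1/2) *\<^sub>R (s * (s - t) + (s - t) * t)"
      by (simp add: algebra_simps)
    also have "norm \<dots> \<le> (norm s * norm (s - t) + norm (s - t) * norm t) / 2"
      using norm_triangle_le[OF add_mono[OF norm_mult_ineq[of s "s - t"] norm_mult_ineq[of "s - t" t]]]
      by simp
    also have "\<dots> \<le> (norm h * norm (s - t) + norm (s - t) * norm h) / 2"
      using st by (intro divide_right_mono add_mono mult_mono) auto
    finally show ?thesis by (simp add: dist_norm mult.commute)
  qed
  ultimately have "\<exists>!s. s \<in> ?S \<and> ?f s = s"
    using h(3) Banach_fix[of ?S "norm h" ?f] by auto
  then obtain s where s: "s \<in> ?S" "?f s = s" by blast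
  then have "h * h + s * s = 2 *\<^sub>R s"
    by (metis scaleR_half_double scaleR_scaleR scaleR_one mult_1 nonzero_mult_div_cancel_left
        times_divide_eq_right mult.commute zero_neq_numeral)
  with s(1) that show thesis by auto
qed

text \<open>
  In the unitization \<open>h + \<i>(1 - s)\<close> is unitary, so its non-unital part \<open>v = h - \<i> s\<close> has norm
  at most 2. The computation uses \<open>v\<close> alone: the unitarity relation becomes
  \<open>v\<^sup>* v = 2 s = -\<i> (v\<^sup>* - v)\<close>, whence \<open>\<parallel>v\<parallel>\<^sup>2 \<le> 2 \<parallel>v\<parallel>\<close>. The sharp bound would be 1, but
  any uniform bound gives continuity.
\<close>

lemma norm_le_of_complement:
  fixes h s :: "'a::cstar_algebra"
  assumes "star h = h" "star s = s" "s * h = h * s" "h * h + s * s = 2 *\<^sub>R s"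
  shows "norm h \<le> 2"
proof -
  define v where "v = h - \<i> *\<^sub>C s"
  have sv: "star v = h + \<i> *\<^sub>C s"
    using assms by (simp add: v_def star_diff star_scaleC)
  have "star v * v = h * h - \<i> *\<^sub>C (h * s) + \<i> *\<^sub>C (s * h) - \<i> *\<^sub>C \<i> *\<^sub>C (s * s)"
    unfolding sv unfolding v_def
    by (simp add: distrib_right right_diff_distrib scaleC_add_right mult_scaleC_left mult_scaleC_right
        complex_vector.scale_right_diff_distrib)
  then have "star v * v = 2 *\<^sub>R s"
    using assms by (simp add: scaleC_scaleC)
  then have "(norm v)\<^sup>2 = norm (2 *\<^sub>R s)"
    by (metis norm_star_mult)
  also have "2 *\<^sub>R s = (-\<i>) *\<^sub>C (star v - v)"
    unfolding sv unfolding v_def by (simp add: scaleR_2 scaleC_add_right scaleC_scaleC)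
  also have "norm \<dots> \<le> 2 * norm v"
    using norm_triangle_ineq4[of "star v" v] by (simp add: norm_scaleC del: complex_vector.scale_minus_left)
  finally have "norm v \<le> 2"
    by (cases "v = 0") (simp_all add: power2_eq_square)
  moreover have "2 *\<^sub>R h = v + star v"
    unfolding sv unfolding v_def by (simp add: scaleR_2)
  then have "2 * norm h \<le> 2 * norm v"
    using norm_triangle_ineq[of v "star v"] by (metis norm_scaleR norm_star abs_numeral mult_2)
  ultimately show ?thesis by simp
qed

locale star_homomorphism =
  fixes A :: "'a::cstar_algebra set" and \<alpha> :: "'a \<Rightarrow> 'b::cstar_algebra"
  assumes A: "cstar_subalgebra A" and lin: "clinear_on A \<alpha>"
    and mult: "x \<in> A \<Longrightarrow> y \<in> A \<Longrightarrow> \<alpha> (x * y) = \<alpha> x * \<alpha> y"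
    and star: "x \<in> A \<Longrightarrow> \<alpha> (star x) = star (\<alpha> x)"
begin

lemma add: "x \<in> A \<Longrightarrow> y \<in> A \<Longrightarrow> \<alpha> (x + y) = \<alpha> x + \<alpha> y"
  and scaleC: "x \<in> A \<Longrightarrow> \<alpha> (c *\<^sub>C x) = c *\<^sub>C \<alpha> x"
  using lin by (auto simp: clinear_on_def)

lemma scaleR: "x \<in> A \<Longrightarrow> \<alpha> (r *\<^sub>R x) = r *\<^sub>R \<alpha> x"
  by (simp add: scaleR_scaleC scaleC)

lemma zero: "\<alpha> 0 = 0"
  using scaleR[OF cstar_subalgebraD(1)[OF A], of 0] by simp

lemma diff: "x \<in> A \<Longrightarrow> y \<in> A \<Longrightarrow> \<alpha> (x - y) = \<alpha> x - \<alpha> y"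
  using add[of "x - y" y] cstar_subalgebraD(8)[OF A] by (simp add: eq_diff_eq)

lemma norm_selfadjoint_le:
  assumes h: "h \<in> A" "star h = h"
  shows "norm (\<alpha> h) \<le> 4 * norm h"
proof (cases "h = 0")
  case False
  \<comment> \<open>Any scaling factor that makes the norm less than 1 would do; here \<open>g\<close> has norm \<open>1/2\<close>.\<close>
  define g where "g = (1 / (2 * norm h)) *\<^sub>R h"
  have g: "g \<in> A" "star g = g" "norm g < 1"
    using h False cstar_subalgebraD(7)[OF A] by (auto simp: g_def star_scaleR)
  obtain s where s: "s \<in> A" "star s = s" "s * g = g * s" "g * g + s * s = 2 *\<^sub>R s"
    using selfadjoint_complement_exists[OF A g] by blast
  have "norm (\<alpha> g) \<le> 2"
    using s g cstar_subalgebraD[OF A]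
    by (intro norm_le_of_complement[of _ "\<alpha> s"])
      (metis star, metis star, metis mult, metis mult add scaleR)
  then show ?thesis
    using False h by (simp add: g_def scaleR field_simps)
qed (simp add: zero)

lemma norm_le:
  assumes a: "a \<in> A"
  shows "norm (\<alpha> a) \<le> 2 * norm a"
proof -
  have "(norm (\<alpha> a))\<^sup>2 = norm (\<alpha> (star a * a))"
    using a cstar_subalgebraD(5)[OF A] by (simp add: mult star norm_star_mult)
  also have "\<dots> \<le> 4 * norm (star a * a)"
    using a cstar_subalgebraD[OF A] by (intro norm_selfadjoint_le) (auto simp: star_mult star_star)
  also have "\<dots> = (2 * norm a)\<^sup>2"
    by (simp add: norm_star_mult power_mult_distrib)
  finally show ?thesis
    by (rule power2_le_imp_le) simp
qed

lemma image_closure_cspan_subset: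
  assumes N: "N \<subseteq> A"
  shows "\<alpha> ` (closure (cspan N) \<inter> A) \<subseteq> closure (cspan (\<alpha> ` N))"
proof clarify
  fix a assume a: "a \<in> closure (cspan N)" "a \<in> A"
  have span: "x \<in> A \<and> \<alpha> x \<in> cspan (\<alpha> ` N)" if "x \<in> cspan N" for x
    using that
    by (rule complex_vector.span_induct)
      (use N cstar_subalgebraD[OF A] in \<open>auto simp: complex_vector.subspace_def zero add scaleC
        complex_vector.span_zero
        intro: complex_vector.span_base complex_vector.span_add complex_vector.span_scale\<close>)
  obtain X where X: "\<And>n. X n \<in> cspan N" "X \<longlonglongrightarrow> a"
    using a(1) unfolding closure_sequential by blast
  have "(\<lambda>n. \<alpha> (X n)) \<longlonglongrightarrow> \<alpha> a"
  proof (rule LIM_zero_cancel, rule Lim_null_comparison)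
    show "\<forall>\<^sub>F n in sequentially. norm (\<alpha> (X n) - \<alpha> a) \<le> 2 * norm (X n - a)"
      using X(1) span a(2) norm_le cstar_subalgebraD(8)[OF A]
      by (intro always_eventually allI) (metis diff)
    show "(\<lambda>n. 2 * norm (X n - a)) \<longlonglongrightarrow> 0"
      using X(2) by (intro tendsto_mult_right_zero tendsto_norm_zero LIM_zero)
  qed
  then show "\<alpha> a \<in> closure (cspan (\<alpha> ` N))"
    unfolding closure_sequential using X(1) span by (intro exI[of _ "\<lambda>n. \<alpha> (X n)"]) auto
qed

end

section \<open>Invariance and the envelope\<close>

text \<open>
  For \<open>m\<close> preserving \<open>K\<close>, \<open>y \<in> K\<^sup>\<bottom>\<close> and \<open>k \<in> K\<close>, the element \<open>y m k\<close> vanishes because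
  \<open>(y m k)(y m k)\<^sup>* = y (m k k\<^sup>* m\<^sup>*) y\<^sup>*\<close>. The equation \<open>y m k = 0\<close> passes to the closed span
  of such \<open>m\<close>, and for a normalizer \<open>n\<close> it yields \<open>y (n k n\<^sup>*) = 0\<close>, that is,
  \<open>n k n\<^sup>* \<in> K\<^sup>\<bottom>\<^sup>\<bottom> = K\<close>.
\<close>

lemma (in abelian_cstar_subalgebra) regular_ideal_invariantI:
  assumes K: "regular_ideal D K"
    and gen: "A \<subseteq> closure (cspan {m \<in> A. preserves m K})"
  shows "invariant_ideal A D K"
proof -
  have ideal: "cstar_ideal D K" and KD: "K \<subseteq> D"
    using K by (auto simp: regular_ideal_def cstar_ideal_def)
  have zero: "y * a * k = 0" if y: "y \<in> annihilator D K" and k: "k \<in> K" and "a \<in> A" for y k a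
  proof -
    let ?Z = "{a. y * a * k = 0}"
    have "y * m * k = 0" if m: "preserves m K" for m
    proof (rule mult_star_self_eq_0D)
      have "y * (m * (k * star k) * star m) = 0"
        using m y cstar_ideal_mult_star[OF subalgebra ideal k]
        by (auto simp: preserves_def annihilator_def)
      moreover have "y * m * k * star (y * m * k) = y * (m * (k * star k) * star m) * star y"
        by (simp add: star_mult mult.assoc)
      ultimately show "y * m * k * star (y * m * k) = 0" by simp
    qed
    then have "cspan {m \<in> A. preserves m K} \<subseteq> ?Z"
      by (intro complex_vector.span_minimal)
        (auto simp: complex_vector.subspace_def distrib_left distrib_right
          mult_scaleC_left mult_scaleC_right)
    moreover have "closed ?Z"
      by (intro closed_Collect_eq continuous_intros)
    ultimately show ?thesis
      using gen \<open>a \<in> A\<close> closure_minimal by blast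
  qed
  have "n * k * star n \<in> K" if n: "n \<in> normalizers A D" and k: "k \<in> K" for n k
  proof -
    have nkn: "n * k * star n \<in> D"
      using n k KD by (auto simp: normalizers_def)
    have "n * k * star n * y = 0" if y: "y \<in> annihilator D K" for y
    proof -
      have "n * k * star n * y = y * (n * k * star n)"
        using nkn y annihilator_subset by (intro commute) auto
      also have "\<dots> = y * n * k * star n"
        by (simp add: mult.assoc)
      also have "\<dots> = 0"
        using zero[OF y k] n by (simp add: normalizers_def)
      finally show ?thesis .
    qed
    then have "n * k * star n \<in> annihilator D (annihilator D K)"
      using nkn by (simp add: annihilator_eq[OF annihilator_subset])
    then show ?thesis
      using K by (simp add: regular_ideal_def)
  qed
  with ideal show ?thesis by (simp add: invariant_ideal_def)
qed

theorem theorem3p15: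
  fixes A D :: "'a::cstar_algebra set"
    and A1 D1 :: "'b::cstar_algebra set"
    and \<alpha> :: "'a \<Rightarrow> 'b"
  assumes "pseudo_cartan_inclusion A D"
    and "cartan_envelope A D A1 D1 \<alpha>"
  shows "lattice_isomorphism (RegInv A D) (RegInv A1 D1)
           (\<lambda>J. annihilator D1 (annihilator D1 (\<alpha> ` J))) \<and>
         (\<forall>K \<in> carrier (RegInv A1 D1). {d \<in> D. \<alpha> d \<in> K} \<in> carrier (RegInv A D)) \<and>
         (\<forall>J \<in> carrier (RegInv A D).
           {d \<in> D. \<alpha> d \<in> annihilator D1 (annihilator D1 (\<alpha> ` J))} = J) \<and>
         (\<forall>K \<in> carrier (RegInv A1 D1).
           annihilator D1 (annihilator D1 (\<alpha> ` {d \<in> D. \<alpha> d \<in> K})) = K)"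
proof -
  note env = assms(2)[unfolded cartan_envelope_def]
  have reg: "regular_inclusion A D" "regular_inclusion A1 D1"
    using env by (auto simp: cartan_inclusion_def)
  have A: "cstar_subalgebra A" and A1: "cstar_subalgebra A1" and DA: "D \<subseteq> A" and D1A1: "D1 \<subseteq> A1"
    and span: "closure (cspan (normalizers A D)) = A"
    using reg by (auto simp: regular_inclusion_def cstar_inclusion_def)
  interpret D: abelian_cstar_subalgebra D
    using reg env by unfold_locales (auto simp: regular_inclusion_def cstar_inclusion_def)
  interpret D1: abelian_cstar_subalgebra D1
    using env by unfold_locales (auto simp: cartan_inclusion_def maximal_abelian_def)
  interpret star_homomorphism A \<alpha>
    using env A by unfold_locales (auto simp: star_monomorphism_def)
  have inj: "inj_on \<alpha> A" and \<alpha>D: "\<alpha> ` D \<subseteq> D1" and \<alpha>N: "\<alpha> ` normalizers A D \<subseteq> normalizers A1 D1"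
    and iip: "ideal_intersection_property D1 (\<alpha> ` D)"
    using env by (auto simp: star_monomorphism_def)
  obtain E where E: "faithful_conditional_expectation A1 D1 E"
    "A1 = cstar_generated (\<alpha> ` A \<union> E ` \<alpha> ` A)"
    using env by blast
  have ED: "E ` \<alpha> ` A \<subseteq> D1"
  proof -
    have "\<alpha> ` A \<subseteq> A1"
      using env by (simp add: star_monomorphism_def)
    then have "E ` \<alpha> ` A \<subseteq> E ` A1"
      by (rule image_mono)
    also have "\<dots> \<subseteq> D1"
      using E(1) by (simp add: faithful_conditional_expectation_def conditional_expectation_def)
    finally show ?thesis .
  qed
  define \<Phi> where "\<Phi> J = annihilator D1 (annihilator D1 (\<alpha> ` J))" for J
  define \<Psi> where "\<Psi> K = {d \<in> D. \<alpha> d \<in> K}" for K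
  have \<Psi>_sub: "\<Psi> K \<subseteq> D" and image_\<Psi>: "\<alpha> ` \<Psi> K = K \<inter> \<alpha> ` D" for K
    by (auto simp: \<Psi>_def)
  have \<Psi>_ann: "\<Psi> (annihilator D1 (\<alpha> ` J)) = annihilator D J" if "J \<subseteq> D" for J
  proof -
    have "\<alpha> d * \<alpha> j = 0 \<longleftrightarrow> d * j = 0" if "d \<in> D" "j \<in> D" for d j
    proof -
      have "d * j \<in> A" "d \<in> A" "j \<in> A"
        using that DA cstar_subalgebraD(4)[OF D.subalgebra] by auto
      then show ?thesis
        using inj_on_eq_iff[OF inj, of "d * j" 0] cstar_subalgebraD(1)[OF A] mult zero by simp
    qed
    then show ?thesis
      using that \<alpha>D by (auto simp: \<Psi>_def annihilator_def subset_iff image_subset_iff)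
  qed
  have ess: "annihilator D1 (\<alpha> ` \<Psi> K) = annihilator D1 K" if "cstar_ideal D1 K" for K
    using D1.annihilator_Int_eq[OF iip that] by (simp add: image_\<Psi>)
  have ideal: "cstar_ideal D1 (annihilator D1 (\<alpha> ` J))" if "J \<subseteq> D" for J
    using that \<alpha>D by (intro D1.cstar_ideal_annihilator) auto
  have \<Phi>_eq: "\<Phi> J = annihilator D1 (\<alpha> ` annihilator D J)" if "J \<subseteq> D" for J
    using ess[OF ideal[OF that]] by (simp add: \<Phi>_def \<Psi>_ann[OF that])
  have \<Psi>\<Phi>: "\<Psi> (\<Phi> J) = J" if "J \<in> carrier (RegInv A D)" for J
    using that by (simp add: \<Phi>_eq \<Psi>_ann annihilator_subset D.regular_ideal_iff)
  have \<Phi>\<Psi>: "\<Phi> (\<Psi> K) = K" if "K \<in> carrier (RegInv A1 D1)" for K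
    using that ess[of K] by (auto simp: \<Phi>_def regular_ideal_def)
  have \<Psi>_in: "\<Psi> K \<in> carrier (RegInv A D)" if K: "K \<in> carrier (RegInv A1 D1)" for K
  proof -
    let ?M = "\<Psi> (annihilator D1 K)"
    have K': "cstar_ideal D1 K" "K \<subseteq> D1" "annihilator D1 (annihilator D1 K) = K"
      using K by (auto simp: regular_ideal_def cstar_ideal_def)
    have "\<Psi> K = annihilator D ?M"
      using ess[OF D1.cstar_ideal_annihilator[OF K'(2)]] \<Psi>_ann[OF \<Psi>_sub, of "annihilator D1 K"] K'(3)
      by simp
    then have "regular_ideal D (\<Psi> K)"
      using D.regular_ideal_annihilator[OF \<Psi>_sub] by simp
    moreover have "n * d * star n \<in> \<Psi> K" if n: "n \<in> normalizers A D" and d: "d \<in> \<Psi> K" for n d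
    proof -
      have dD: "d \<in> D" "\<alpha> d \<in> K" and nA: "n \<in> A" and ndn: "n * d * star n \<in> D"
        using d n by (auto simp: \<Psi>_def normalizers_def)
      have "d \<in> A" "n * d \<in> A" "star n \<in> A"
        using dD DA nA cstar_subalgebraD[OF A] by auto
      then have "\<alpha> (n * d * star n) = \<alpha> n * \<alpha> d * star (\<alpha> n)"
        using nA by (simp add: mult star)
      also have "\<dots> \<in> K"
        using K n dD \<alpha>N by (auto simp: invariant_ideal_def)
      finally show ?thesis
        using ndn by (simp add: \<Psi>_def)
    qed
    ultimately show ?thesis
      by (auto simp: invariant_ideal_def regular_ideal_def)
  qed
  have \<Phi>_in: "\<Phi> J \<in> carrier (RegInv A1 D1)" if J: "J \<in> carrier (RegInv A D)" for J
  proof -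
    have JD: "J \<subseteq> D" and J_ideal: "cstar_ideal D J"
      using J by (auto simp: regular_ideal_def cstar_ideal_def)
    have sub: "\<alpha> ` J \<subseteq> D1" using JD \<alpha>D by auto
    let ?K = "\<Phi> J"
    have K: "regular_ideal D1 ?K"
      unfolding \<Phi>_def by (rule D1.regular_ideal_annihilator[OF annihilator_subset])
    then have K_ideal: "cstar_ideal D1 ?K" by (simp add: regular_ideal_def)
    \<comment> \<open>The span of \<open>?G\<close> is shown to be dense in \<open>A1\<close>, by exhibiting the generators of \<open>A1\<close>
      in its closure.\<close>
    let ?G = "{m \<in> A1. preserves m ?K}"
    have "\<alpha> n \<in> ?G" if n: "n \<in> normalizers A D" for n
    proof -
      have nA: "n \<in> A" and n1: "\<alpha> n \<in> normalizers A1 D1"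
        using n \<alpha>N by (auto simp: normalizers_def)
      have pD1: "preserves (\<alpha> n) D1" by (rule normalizer_preserves[OF n1])
      have "preserves n J"
        using J n by (simp add: invariant_ideal_iff_preserves[OF A])
      moreover have "\<alpha> n * \<alpha> j * star (\<alpha> n) = \<alpha> (n * j * star n)"
        "star (\<alpha> n) * \<alpha> j * \<alpha> n = \<alpha> (star n * j * n)" if "j \<in> J" for j
        using that nA JD DA cstar_subalgebraD[OF A] by (auto simp: mult star subset_iff)
      ultimately have pJ: "preserves (\<alpha> n) (\<alpha> ` J)"
        by (auto simp: preserves_def)
      have "\<alpha> j * star (\<alpha> j) \<in> \<alpha> ` J" if "j \<in> J" for j
      proof -
        have "\<alpha> j * star (\<alpha> j) = \<alpha> (j * star j)"
          using that JD DA cstar_subalgebraD[OF A] by (auto simp: mult star subset_iff)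
        then show ?thesis
          using cstar_ideal_mult_star[OF D.subalgebra J_ideal that] by simp
      qed
      \<comment> \<open>Invariance is inherited twice, from \<open>\<alpha>(J)\<close> to \<open>\<alpha>(J)\<^sup>\<bottom>\<close> and from there to \<open>?K\<close>.\<close>
      then have "preserves (\<alpha> n) (annihilator D1 (\<alpha> ` J))"
        by (intro D1.annihilator_preserved[OF sub _ pD1 pJ]) auto
      then have "preserves (\<alpha> n) ?K"
        unfolding \<Phi>_def
        by (intro D1.annihilator_preserved[OF annihilator_subset _ pD1]
            cstar_ideal_mult_star[OF D1.subalgebra ideal[OF JD]])
      with n1 show ?thesis by (simp add: normalizers_def)
    qed
    then have "closure (cspan (\<alpha> ` normalizers A D)) \<subseteq> closure (cspan ?G)"
      by (intro closure_mono complex_vector.span_mono) blast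
    then have "\<alpha> ` A \<subseteq> closure (cspan ?G)"
      using image_closure_cspan_subset[of "normalizers A D"] span by (auto simp: normalizers_def)
    moreover have "D1 \<subseteq> ?G"
      using K_ideal D1A1 cstar_subalgebraD(5)[OF D1.subalgebra]
      by (auto simp: cstar_ideal_def preserves_def)
    then have "D1 \<subseteq> closure (cspan ?G)"
      using closure_subset complex_vector.span_superset by blast
    moreover have "cstar_subalgebra (closure (cspan ?G))"
      using A1 by (intro cstar_subalgebra_closure_cspan)
        (auto intro: preserves_mult preserves_star cstar_subalgebraD)
    ultimately have "A1 \<subseteq> closure (cspan ?G)"
      unfolding E(2) cstar_generated_def using ED by (intro hull_minimal) blast+
    with K show ?thesis
      by (simp add: D1.regular_ideal_invariantI)
  qed
  have bij: "bij_betw \<Phi> (carrier (RegInv A D)) (carrier (RegInv A1 D1))"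
    by (intro bij_betwI[where g = \<Psi>] funcsetI) (fact \<Phi>_in \<Psi>_in \<Psi>\<Phi> \<Phi>\<Psi>)+
  have "\<Phi> J \<subseteq> \<Phi> J'" if "J \<subseteq> J'" for J J'
    unfolding \<Phi>_def using that by (intro annihilator_antimono image_mono)
  moreover have "\<Psi> K \<subseteq> \<Psi> K'" if "K \<subseteq> K'" for K K'
    using that by (auto simp: \<Psi>_def)
  ultimately have "\<Phi> J \<subseteq> \<Phi> J' \<longleftrightarrow> J \<subseteq> J'"
    if "J \<in> carrier (RegInv A D)" "J' \<in> carrier (RegInv A D)" for J J'
    using \<Psi>\<Phi>[OF that(1)] \<Psi>\<Phi>[OF that(2)] by metis
  then have "lattice_isomorphism (RegInv A D) (RegInv A1 D1) \<Phi>"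
    by (intro order_isomorphism_lattice_isomorphism D.lattice_RegInv D1.lattice_RegInv A A1 bij)
      (simp only: RegInv_simps)
  moreover note \<Psi>_in \<Psi>\<Phi> \<Phi>\<Psi>
  ultimately show ?thesis
    unfolding \<Phi>_def \<Psi>_def by blast
qed

end
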